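(* Let $F=(f_1,\ldots,f_m)^\top:\mathbb{R}^n\to\mathbb{R}^m$ be continuously differentiable, let $s\in\mathbb{N}$ with $1\le s<n$, and let $\Omega=\{x\in\mathbb{R}^n\mid\|x\|_0\le s\}$. Consider the Sparse Front Steepest Descent algorithm (SFSD) run indefinitely from an initial set $\mathcal{X}^0$, producing the sets $\mathcal{X}^k$, $k=0,1,2,\ldots$. Let $J\subseteq\{1,\ldots,n\}$ with $|J|=s$ be a super support set and let $X_J^k=\{x\mid (x,J)\in\mathcal{X}^k\}$ for all $k$. Assume that $X_J^0$ is a set of mutually nondominated points and that there exists $x_0^J\in X_J^0$ such that the set $$\widehat{\mathcal{L}}_F(x_0^J)=\bigcup_{j=1}^m\{x\in\Omega\mid f_j(x)\le f_j(x_0^J)\}$$ is compact. Let $\{X_J^k\}$ be the sequence of sets of nondominated points associated with $J$ produced by SFSD, and let $\{x_{j_k}^J\}$ be a linked sequence. Then $\{x_{j_k}^J\}$ admits accumulation points, and each accumulation point satisfies the Multi-Objective Lu-Zhang first-order optimality conditions (MOLZ conditions) for the problem $\min_{x\in\Omega}F(x)$.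
   Context: Notation. $\|x\|_0$ is the number of nonzero components of $x$; $\|\cdot\|$ is the Euclidean norm; $\boldsymbol{1}_m$ is the all-ones vector in $\mathbb{R}^m$. For $u,v\in\mathbb{R}^m$, $u\le v$ means $u_j\le v_j$ for all $j$, and $u\lneqq v$ means $u\le v$ and $u\ne v$. A point $x$ dominates $y$ (w.r.t. $F$) if $F(x)\lneqq F(y)$; points are mutually nondominated if none of them dominates another. For $x\in\Omega$, a super support set of $x$ is an index set $J\subseteq\{1,\ldots,n\}$ with $\{i\mid x_i\neq0\}\subseteq J$ and $|J|=s$; $\mathcal{J}(x)$ denotes the set of all super support sets of $x$. For an index set $J$, $\bar J=\{1,\ldots,n\}\setminus J$, and $d_{\bar J}$ is the subvector of $d$ indexed by $\bar J$. Directions. For a set $J$ with $|J|=s$, a nonempty $I\subseteq\{1,\ldots,m\}$ and $x\in\mathbb{R}^n$, let $$\theta_J^I(x)=\min\Big\{\max_{j\in I}\nabla f_j(x)^\top d+\tfrac12\|d\|^2\ \Big|\ d\in\mathbb{R}^n,\ d_{\bar J}=0\Big\},$$ and let $d_J^I(x)$ be its unique minimizer. Write $\theta_J(x)=\theta_J^{\{1,\ldots,m\}}(x)$ and $d_J(x)=d_J^{\{1,\ldots,m\}}(x)$. MOLZ conditions. A point $\bar x\in\Omega$ satisfies the MOLZ conditions if there exists $J\in\mathcal{J}(\bar x)$ such that $\theta_J(\bar x)=0$. SFSD algorithm. Parameters: $\alpha_0>0$, $\delta\in(0,1)$, $\gamma\in(0,1)$. The initial set $\mathcal{X}^0$ is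 a finite set of pairs $(x,J_x)$ with $x\in\Omega$ and $J_x\in\mathcal{J}(x)$, such that for any two pairs $(x,J_x),(y,J_y)\in\mathcal{X}^0$ with $J_x=J_y$ the points $x$ and $y$ are mutually nondominated. At iteration $k=0,1,2,\ldots$, set $\widehat{\mathcal{X}}^k=\mathcal{X}^k$. Then, for each $(x_c,J_{x_c})\in\mathcal{X}^k$ in turn, if $(x_c,J_{x_c})$ still belongs to the current $\widehat{\mathcal{X}}^k$, do the following, writing $J=J_{x_c}$: 1. If $\theta_J(x_c)<0$, let $\alpha_c^k=\max_{h\in\mathbb{N}}\{\alpha_0\delta^h\mid F(x_c+\alpha_0\delta^hd_J(x_c))\le F(x_c)+\boldsymbol{1}_m\gamma\alpha_0\delta^h\theta_J(x_c)\}$ (with $h=0,1,2,\ldots$); otherwise let $\alpha_c^k=0$. Set $z_c^k=x_c+\alpha_c^kd_J(x_c)$. 2. Remove from $\widehat{\mathcal{X}}^k$ all pairs $(y,J_y)$ with $J_y=J$ and $F(z_c^k)\lneqq F(y)$, and add $(z_c^k,J)$ to $\widehat{\mathcal{X}}^k$. 3. For each nonempty $I\subseteq\{1,\ldots,m\}$ with $\theta_J^I(z_c^k)<0$, in turn: if $(z_c^k,J)$ belongs to the current $\widehat{\mathcal{X}}^k$, let $\alpha_c^I=\max_{h\in\mathbb{N}}\{\alpha_0\delta^h\mid \forall (y,J_y)\in\widehat{\mathcal{X}}^k \text{ with } J_y=J\ \exists j\in\{1,\ldots,m\}:\ f_j(z_c^k+\alpha_0\delta^hd_J^I(z_c^k))<f_j(y)\}$,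 set $\hat z=z_c^k+\alpha_c^Id_J^I(z_c^k)$, remove from $\widehat{\mathcal{X}}^k$ all pairs $(y,J_y)$ with $J_y=J$ and $F(\hat z)\lneqq F(y)$, and add $(\hat z,J)$ to $\widehat{\mathcal{X}}^k$. After all pairs of $\mathcal{X}^k$ have been treated, set $\mathcal{X}^{k+1}=\widehat{\mathcal{X}}^k$. Linked sequence. A linked sequence (for $J$) is a sequence $\{x_{j_k}^J\}$ such that, for all $k$, $x_{j_k}^J\in X_J^k$ and, for $k\ge1$, $x_{j_k}^J$ is generated at iteration $k-1$ of the algorithm by the point $x_{j_{k-1}}^J\in X_J^{k-1}$; that is, when the pair $(x_c,J_{x_c})=(x_{j_{k-1}}^J,J)$ is treated at iteration $k-1$, $x_{j_k}^J$ is either the resulting point $z_c^{k-1}$ or one of the resulting points $\hat z$. *)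

theory Defs
  imports "HOL-Analysis.Analysis"
begin

text \<open>
  Points live in \<^typ>\<open>real ^ 'n\<close> and objective values in \<^typ>\<open>real ^ 'm\<close>; the
  component functions are \<open>\<lambda>x. F x $ j\<close>. The library orders \<^typ>\<open>real ^ 'm\<close>
  componentwise, and \<open>u < v\<close> there means \<open>u \<le> v\<close> together with \<open>u \<noteq> v\<close> (it is
  not strict in every component), so \<open>F x < F y\<close> says that \<open>x\<close> dominates \<open>y\<close>.
\<close>

definition grad :: "('a::real_inner \<Rightarrow> real) \<Rightarrow> 'a \<Rightarrow> 'a" where
  "grad f x = (THE D. GDERIV f x :> D)"

definition cont_differentiable :: "(real ^ 'n \<Rightarrow> real ^ 'm) \<Rightarrow> bool" where
  "cont_differentiable F \<longleftrightarrow>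
     (\<forall>x. F differentiable (at x)) \<and> (\<forall>j. continuous_on UNIV (grad (\<lambda>x. F x $ j)))"

definition supp :: "real ^ 'n \<Rightarrow> 'n set" where
  "supp x = {i. x $ i \<noteq> 0}"

definition sparse_set :: "nat \<Rightarrow> (real ^ 'n) set" where
  "sparse_set s = {x. card (supp x) \<le> s}"

definition super_supports :: "nat \<Rightarrow> real ^ 'n \<Rightarrow> 'n set set" where
  "super_supports s x = {J. supp x \<subseteq> J \<and> card J = s}"

definition mutually_nondominated :: "(real ^ 'n \<Rightarrow> real ^ 'm) \<Rightarrow> (real ^ 'n) set \<Rightarrow> bool" where
  "mutually_nondominated F A \<longleftrightarrow> (\<forall>x\<in>A. \<forall>y\<in>A. \<not> F x < F y)"


definition dir_space :: "'n set \<Rightarrow> (real ^ 'n) set" where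
  "dir_space J = {d. \<forall>i. i \<notin> J \<longrightarrow> d $ i = 0}"

definition dir_objective ::
    "(real ^ 'n \<Rightarrow> real ^ 'm) \<Rightarrow> 'm set \<Rightarrow> real ^ 'n \<Rightarrow> real ^ 'n \<Rightarrow> real" where
  "dir_objective F I x d = (MAX j\<in>I. grad (\<lambda>y. F y $ j) x \<bullet> d) + 1/2 * (norm d)\<^sup>2"

text \<open>
  For nonempty \<open>I\<close> the objective is continuous, strongly convex and coercive, so the
  infimum below is a minimum and the minimizer exists and is unique.
\<close>

definition theta :: "(real ^ 'n \<Rightarrow> real ^ 'm) \<Rightarrow> 'n set \<Rightarrow> 'm set \<Rightarrow> real ^ 'n \<Rightarrow> real" where
  "theta F J I x = (INF d\<in>dir_space J. dir_objective F I x d)"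

definition dir :: "(real ^ 'n \<Rightarrow> real ^ 'm) \<Rightarrow> 'n set \<Rightarrow> 'm set \<Rightarrow> real ^ 'n \<Rightarrow> real ^ 'n" where
  "dir F J I x = (THE d. is_arg_min (dir_objective F I x) (\<lambda>d. d \<in> dir_space J) d)"

definition MOLZ :: "(real ^ 'n \<Rightarrow> real ^ 'm) \<Rightarrow> nat \<Rightarrow> real ^ 'n \<Rightarrow> bool" where
  "MOLZ F s x \<longleftrightarrow> x \<in> sparse_set s \<and> (\<exists>J\<in>super_supports s x. theta F J UNIV x = 0)"


type_synonym 'n archive = "((real ^ 'n) \<times> 'n set) set"

definition front :: "'n archive \<Rightarrow> 'n set \<Rightarrow> (real ^ 'n) set" where
  "front X J = {x. (x, J) \<in> X}"

definition insert_filter ::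
    "(real ^ 'n \<Rightarrow> real ^ 'm) \<Rightarrow> 'n set \<Rightarrow> real ^ 'n \<Rightarrow> 'n archive \<Rightarrow> 'n archive" where
  "insert_filter F J z X = insert (z, J) (X - {(y, Jy). Jy = J \<and> F z < F y})"

definition armijo_step ::
    "(real ^ 'n \<Rightarrow> real ^ 'm) \<Rightarrow> real \<Rightarrow> real \<Rightarrow> real \<Rightarrow> 'n set \<Rightarrow> real ^ 'n \<Rightarrow> real" where
  "armijo_step F \<alpha>0 \<delta> \<gamma> J x =
     (if theta F J UNIV x < 0
      then GREATEST \<alpha>. \<exists>h::nat. \<alpha> = \<alpha>0 * \<delta> ^ h \<and>
             F (x + \<alpha> *\<^sub>R dir F J UNIV x) \<le> F x + (\<gamma> * \<alpha> * theta F J UNIV x) *\<^sub>R 1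
      else 0)"

definition refine_point ::
    "(real ^ 'n \<Rightarrow> real ^ 'm) \<Rightarrow> real \<Rightarrow> real \<Rightarrow> real \<Rightarrow> 'n set \<Rightarrow> real ^ 'n \<Rightarrow> real ^ 'n" where
  "refine_point F \<alpha>0 \<delta> \<gamma> J x = x + armijo_step F \<alpha>0 \<delta> \<gamma> J x *\<^sub>R dir F J UNIV x"

definition explore_step ::
    "(real ^ 'n \<Rightarrow> real ^ 'm) \<Rightarrow> real \<Rightarrow> real \<Rightarrow> 'n set \<Rightarrow> 'm set \<Rightarrow> real ^ 'n \<Rightarrow> 'n archive \<Rightarrow> real"
  where
  "explore_step F \<alpha>0 \<delta> J I z X =
     (GREATEST \<alpha>. \<exists>h::nat. \<alpha> = \<alpha>0 * \<delta> ^ h \<and>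
        (\<forall>y\<in>front X J. \<exists>j. F (z + \<alpha> *\<^sub>R dir F J I z) $ j < F y $ j))"

definition explore_point ::
    "(real ^ 'n \<Rightarrow> real ^ 'm) \<Rightarrow> real \<Rightarrow> real \<Rightarrow> 'n set \<Rightarrow> 'm set \<Rightarrow> real ^ 'n \<Rightarrow> 'n archive \<Rightarrow> real ^ 'n"
  where
  "explore_point F \<alpha>0 \<delta> J I z X = z + explore_step F \<alpha>0 \<delta> J I z X *\<^sub>R dir F J I z"

definition explore ::
    "(real ^ 'n \<Rightarrow> real ^ 'm) \<Rightarrow> real \<Rightarrow> real \<Rightarrow> 'n set \<Rightarrow> real ^ 'n \<Rightarrow> 'm set \<Rightarrow> 'n archive \<Rightarrow> 'n archive"
  where
  "explore F \<alpha>0 \<delta> J z I X =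
     (if (z, J) \<in> X then insert_filter F J (explore_point F \<alpha>0 \<delta> J I z X) X else X)"

text \<open>
  The order in which the sets \<open>I\<close> and the pairs of the current archive are treated is
  left open by the algorithm. Here the orders are explicit: \<open>Is p\<close> lists the sets \<open>I\<close>
  used when the pair \<open>p\<close> is treated, and a list \<open>ps\<close> enumerates the archive.
\<close>

definition treat ::
    "(real ^ 'n \<Rightarrow> real ^ 'm) \<Rightarrow> real \<Rightarrow> real \<Rightarrow> real \<Rightarrow> ((real ^ 'n) \<times> 'n set \<Rightarrow> 'm set list) \<Rightarrow>
     (real ^ 'n) \<times> 'n set \<Rightarrow> 'n archive \<Rightarrow> 'n archive" where
  "treat F \<alpha>0 \<delta> \<gamma> Is p X =
     (if p \<in> X
      then let J = snd p; z = refine_point F \<alpha>0 \<delta> \<gamma> J (fst p)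
           in fold (explore F \<alpha>0 \<delta> J z) (Is p) (insert_filter F J z X)
      else X)"

definition sfsd_init :: "(real ^ 'n \<Rightarrow> real ^ 'm) \<Rightarrow> nat \<Rightarrow> 'n archive \<Rightarrow> bool" where
  "sfsd_init F s X \<longleftrightarrow> finite X \<and>
     (\<forall>(x, J)\<in>X. x \<in> sparse_set s \<and> J \<in> super_supports s x) \<and>
     (\<forall>J. mutually_nondominated F (front X J))"

definition sfsd_run ::
    "(real ^ 'n \<Rightarrow> real ^ 'm) \<Rightarrow> nat \<Rightarrow> real \<Rightarrow> real \<Rightarrow> real \<Rightarrow>
     (nat \<Rightarrow> 'n archive) \<Rightarrow> (nat \<Rightarrow> ((real ^ 'n) \<times> 'n set) list) \<Rightarrow>
     (nat \<Rightarrow> (real ^ 'n) \<times> 'n set \<Rightarrow> 'm set list) \<Rightarrow> bool" where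
  "sfsd_run F s \<alpha>0 \<delta> \<gamma> X ps Is \<longleftrightarrow> sfsd_init F s (X 0) \<and>
     (\<forall>k. distinct (ps k) \<and> set (ps k) = X k \<and>
          (\<forall>(x, J)\<in>X k. distinct (Is k (x, J)) \<and>
             set (Is k (x, J)) =
               {I. I \<noteq> {} \<and> theta F J I (refine_point F \<alpha>0 \<delta> \<gamma> J x) < 0}) \<and>
          X (Suc k) = fold (treat F \<alpha>0 \<delta> \<gamma> (Is k)) (ps k) (X k))"

text \<open>
  The point \<open>y\<close> is produced when the pair \<open>(x, J)\<close> is treated (at position \<open>i\<close>, with
  \<open>Y\<close> the archive at that moment) in an iteration starting from the archive \<open>X\<close>.
\<close>

definition generated_by ::
    "(real ^ 'n \<Rightarrow> real ^ 'm) \<Rightarrow> real \<Rightarrow> real \<Rightarrow> real \<Rightarrow>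
     'n archive \<Rightarrow> ((real ^ 'n) \<times> 'n set) list \<Rightarrow> ((real ^ 'n) \<times> 'n set \<Rightarrow> 'm set list) \<Rightarrow>
     'n set \<Rightarrow> real ^ 'n \<Rightarrow> real ^ 'n \<Rightarrow> bool" where
  "generated_by F \<alpha>0 \<delta> \<gamma> X ps Is J x y \<longleftrightarrow>
     (\<exists>i<length ps. ps ! i = (x, J) \<and>
        (let Y = fold (treat F \<alpha>0 \<delta> \<gamma> Is) (take i ps) X;
             z = refine_point F \<alpha>0 \<delta> \<gamma> J x
         in (x, J) \<in> Y \<and>
            (y = z \<or>
             (\<exists>l<length (Is (x, J)).
                let Z = fold (explore F \<alpha>0 \<delta> J z) (take l (Is (x, J))) (insert_filter F J z Y)
                in (z, J) \<in> Z \<and> y = explore_point F \<alpha>0 \<delta> J (Is (x, J) ! l) z Z))))"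

definition linked_sequence ::
    "(real ^ 'n \<Rightarrow> real ^ 'm) \<Rightarrow> real \<Rightarrow> real \<Rightarrow> real \<Rightarrow>
     (nat \<Rightarrow> 'n archive) \<Rightarrow> (nat \<Rightarrow> ((real ^ 'n) \<times> 'n set) list) \<Rightarrow>
     (nat \<Rightarrow> (real ^ 'n) \<times> 'n set \<Rightarrow> 'm set list) \<Rightarrow> 'n set \<Rightarrow> (nat \<Rightarrow> real ^ 'n) \<Rightarrow> bool" where
  "linked_sequence F \<alpha>0 \<delta> \<gamma> X ps Is J xs \<longleftrightarrow>
     (\<forall>k. xs k \<in> front (X k) J) \<and>
     (\<forall>k. generated_by F \<alpha>0 \<delta> \<gamma> (X k) (ps k) (Is k) J (xs k) (xs (Suc k)))"

definition accumulation_point :: "(nat \<Rightarrow> 'a::topological_space) \<Rightarrow> 'a \<Rightarrow> bool" where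
  "accumulation_point xs a \<longleftrightarrow> (\<exists>r. strict_mono r \<and> (xs \<circ> r) \<longlonglongrightarrow> a)"

end

theory Submission
  imports Defs
begin

text \<open>
  Let \<open>a\<close> be an accumulation point with \<open>theta F J UNIV a < 0\<close>. Near \<open>a\<close> the Armijo steps are
  bounded away from 0, so there is \<open>c > 0\<close> such that refining any point near \<open>a\<close> decreases every
  objective by at least \<open>c\<close>; this needs only upper semicontinuity of \<open>theta\<close> and a local bound on
  the directions. The refined point of \<open>xs k\<close> enters the archive, and from then on every archive
  contains a point with the same support set that is at least as good. For \<open>l > k\<close> the point
  \<open>xs l\<close> is not dominated by it, so some objective satisfies \<open>F (xs l) $ j \<le> F (xs k) $ j - c\<close>
  whenever \<open>xs k\<close> is near \<open>a\<close>, which contradicts convergence of \<open>F (xs k)\<close> along the subsequence.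
  The same two facts, applied to \<open>x0\<close>, keep the sequence in the compact set.
\<close>

section \<open>Gradients of the components and derivatives along lines\<close>

lemma GDERIV_grad:
  assumes "cont_differentiable F"
  shows "GDERIV (\<lambda>y. F y $ j) x :> grad (\<lambda>y. F y $ j) x"
proof -
  have "F differentiable (at x)"
    using assms by (simp add: cont_differentiable_def)
  then obtain F' where "(F has_derivative F') (at x)"
    by (auto simp: differentiable_def)
  then have D: "((\<lambda>y. F y $ j) has_derivative (\<lambda>h. F' h $ j)) (at x)"
    by (rule bounded_linear.has_derivative[OF bounded_linear_vec_nth])
  then have "linear (\<lambda>h. F' h $ j)"
    by (rule has_derivative_linear)
  \<comment> \<open>Riesz representation: the adjoint of a linear functional, evaluated at 1, is the
    vector that represents it.\<close>
  then have "h \<bullet> adjoint (\<lambda>h. F' h $ j) 1 = F' h $ j" for h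
    by (simp add: adjoint_works)
  with D have G: "GDERIV (\<lambda>y. F y $ j) x :> adjoint (\<lambda>h. F' h $ j) 1"
    by (simp add: gderiv_def)
  \<comment> \<open>Uniqueness of the representing vector is what gives the definite description in
    \<open>grad\<close> its value.\<close>
  have "D' = adjoint (\<lambda>h. F' h $ j) 1" if "GDERIV (\<lambda>y. F y $ j) x :> D'" for D'
  proof -
    have "(\<lambda>h. h \<bullet> D') = (\<lambda>h. h \<bullet> adjoint (\<lambda>h. F' h $ j) 1)"
      using that[unfolded gderiv_def] G[unfolded gderiv_def] by (rule has_derivative_unique)
    then have "\<forall>h. h \<bullet> D' = h \<bullet> adjoint (\<lambda>h. F' h $ j) 1"
      by (rule fun_cong[THEN allI])
    then show ?thesis
      by (simp only: vector_eq_ldot)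
  qed
  then have "grad (\<lambda>y. F y $ j) x = adjoint (\<lambda>h. F' h $ j) 1"
    unfolding grad_def by (intro the_equality G)
  with G show ?thesis by simp
qed

text \<open>The chain rule reduces both line searches to one real variable: it feeds the mean value
  theorem in the Armijo estimate and the first-order descent argument for exploration steps.\<close>

lemma DERIV_along_direction:
  assumes "cont_differentiable F"
  shows "((\<lambda>t. F (x + t *\<^sub>R d) $ j) has_real_derivative grad (\<lambda>y. F y $ j) (x + t *\<^sub>R d) \<bullet> d) (at t)"
proof -
  have "((\<lambda>y. F y $ j) has_derivative (\<lambda>h. h \<bullet> grad (\<lambda>y. F y $ j) (x + t *\<^sub>R d))) (at (x + t *\<^sub>R d))"
    using GDERIV_grad[OF assms] by (simp add: gderiv_def)
  moreover have "((\<lambda>t. x + t *\<^sub>R d) has_derivative (\<lambda>h. h *\<^sub>R d)) (at t)"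
    by (auto intro!: derivative_eq_intros)
  ultimately have "((\<lambda>t. F (x + t *\<^sub>R d) $ j) has_derivative
      (\<lambda>h. (h *\<^sub>R d) \<bullet> grad (\<lambda>y. F y $ j) (x + t *\<^sub>R d))) (at t)"
    by (rule has_derivative_compose[rotated])
  then show ?thesis
    by (simp add: has_field_derivative_def inner_commute mult_commute_abs)
qed

lemma isCont_grad:
  assumes "cont_differentiable F"
  shows "isCont (grad (\<lambda>y. F y $ j)) x"
  using assms by (simp add: cont_differentiable_def continuous_on_eq_continuous_at)

lemma isCont_cont_differentiable:
  assumes "cont_differentiable F"
  shows "isCont F x"
  using assms by (simp add: cont_differentiable_def differentiable_imp_continuous_within)

section \<open>The direction subproblem: existence and uniqueness of the minimizer\<close>

lemma continuous_on_MAX: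
  fixes f :: "'i \<Rightarrow> 'a::topological_space \<Rightarrow> real"
  assumes "finite I" "I \<noteq> {}" "\<And>i. i \<in> I \<Longrightarrow> continuous_on S (f i)"
  shows "continuous_on S (\<lambda>x. MAX i\<in>I. f i x)"
  using assms
proof (induction I rule: finite_ne_induct)
  case (singleton i)
  then show ?case by simp
next
  case (insert i I)
  then show ?case by (auto intro!: continuous_on_max)
qed

lemma zero_in_dir_space [simp]: "0 \<in> dir_space J"
  by (simp add: dir_space_def)

lemma dir_space_add: "x \<in> dir_space J \<Longrightarrow> y \<in> dir_space J \<Longrightarrow> x + y \<in> dir_space J"
  by (simp add: dir_space_def)

lemma dir_space_scale: "x \<in> dir_space J \<Longrightarrow> c *\<^sub>R x \<in> dir_space J"
  by (simp add: dir_space_def)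

lemma closed_dir_space: "closed (dir_space J)"
proof -
  have "dir_space J = (\<Inter>i\<in>-J. {d. d $ i = 0})"
    by (auto simp: dir_space_def)
  then show ?thesis
    by (auto intro!: closed_Collect_eq continuous_intros)
qed

lemma supp_subset_iff: "supp x \<subseteq> J \<longleftrightarrow> x \<in> dir_space J"
  by (auto simp: supp_def dir_space_def)

lemma dir_objective_0 [simp]: "I \<noteq> {} \<Longrightarrow> dir_objective F I x 0 = 0"
  by (simp add: dir_objective_def)

lemma dir_objective_ge:
  fixes F :: "real ^ 'n \<Rightarrow> real ^ 'm"
  assumes "j \<in> I"
  shows "grad (\<lambda>y. F y $ j) x \<bullet> d + 1/2 * (norm d)\<^sup>2 \<le> dir_objective F I x d"
  unfolding dir_objective_def using assms by (auto intro!: Max_ge)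

text \<open>Strong convexity at midpoints, from which uniqueness of the minimizer follows: a maximum
  of linear forms is convex, and the parallelogram law for the quadratic term leaves the gap
  \<open>1/8 * (norm (d - e))\<^sup>2\<close>.\<close>

lemma dir_objective_midpoint:
  fixes F :: "real ^ 'n \<Rightarrow> real ^ 'm"
  assumes "I \<noteq> {}"
  shows "dir_objective F I x ((1/2) *\<^sub>R (d + e)) + 1/8 * (norm (d - e))\<^sup>2
    \<le> 1/2 * (dir_objective F I x d + dir_objective F I x e)"
proof -
  let ?g = "\<lambda>j. grad (\<lambda>y. F y $ j) x"
  have "(MAX j\<in>I. ?g j \<bullet> ((1/2) *\<^sub>R (d + e))) \<le> 1/2 * ((MAX j\<in>I. ?g j \<bullet> d) + (MAX j\<in>I. ?g j \<bullet> e))"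
  proof (rule Max.boundedI)
    fix a assume "a \<in> (\<lambda>j. ?g j \<bullet> ((1/2) *\<^sub>R (d + e))) ` I"
    then obtain j where "a = ?g j \<bullet> ((1/2) *\<^sub>R (d + e))" and j: "j \<in> I" by blast
    moreover have "?g j \<bullet> d \<le> (MAX j\<in>I. ?g j \<bullet> d)" "?g j \<bullet> e \<le> (MAX j\<in>I. ?g j \<bullet> e)"
      by (rule Max_ge; use j in simp)+
    ultimately show "a \<le> 1/2 * ((MAX j\<in>I. ?g j \<bullet> d) + (MAX j\<in>I. ?g j \<bullet> e))"
      unfolding inner_add_right inner_scaleR_right by argo
  qed (use assms in simp_all)
  moreover have "(norm (d + e))\<^sup>2 + (norm (d - e))\<^sup>2 = 2 * (norm d)\<^sup>2 + 2 * (norm e)\<^sup>2"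
    unfolding power2_norm_eq_inner by (simp add: inner_add inner_diff inner_commute[of e d])
  moreover have "(norm ((1/2) *\<^sub>R (d + e)))\<^sup>2 = 1/4 * (norm (d + e))\<^sup>2"
    by (simp only: norm_scaleR power_mult_distrib) (simp add: power2_eq_square)
  ultimately show ?thesis
    unfolding dir_objective_def by argo
qed

lemma dir_objective_attains_min:
  fixes F :: "real ^ 'n \<Rightarrow> real ^ 'm"
  assumes "I \<noteq> {}"
  shows "\<exists>d\<in>dir_space J. \<forall>e\<in>dir_space J. dir_objective F I x d \<le> dir_objective F I x e"
proof -
  obtain j where j: "j \<in> I" using assms by blast
  \<comment> \<open>Coercivity radius: if \<open>norm e\<close> exceeds \<open>R\<close>,
    Cauchy-Schwarz makes the objective at \<open>e\<close> nonnegative, hence no better than its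
    value 0 at the origin. A minimizer over the compact ball is therefore global.\<close>
  define R where "R = 2 * norm (grad (\<lambda>y. F y $ j) x)"
  have "compact (dir_space J \<inter> cball 0 R)"
    by (simp add: closed_Int_compact closed_dir_space)
  moreover have "dir_space J \<inter> cball 0 R \<noteq> {}"
    using zero_in_dir_space[of J] by (fastforce simp: R_def)
  moreover have "continuous_on (dir_space J \<inter> cball 0 R) (dir_objective F I x)"
    unfolding dir_objective_def using assms
    by (intro continuous_intros continuous_on_MAX) auto
  ultimately obtain d where d: "d \<in> dir_space J \<inter> cball 0 R"
    and min: "\<And>e. e \<in> dir_space J \<inter> cball 0 R \<Longrightarrow> dir_objective F I x d \<le> dir_objective F I x e"
    using continuous_attains_inf[of "dir_space J \<inter> cball 0 R" "dir_objective F I x"] by blast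
  have "dir_objective F I x d \<le> dir_objective F I x e" if e: "e \<in> dir_space J" for e
  proof (cases "norm e \<le> R")
    case True
    then show ?thesis using e min by simp
  next
    case False
    have "dir_objective F I x d \<le> 0"
      using min[of 0] assms by (simp add: R_def)
    also have "0 \<le> norm e * (1/2 * norm e - norm (grad (\<lambda>y. F y $ j) x))"
      using False by (intro mult_nonneg_nonneg) (simp_all add: R_def)
    also have "\<dots> \<le> grad (\<lambda>y. F y $ j) x \<bullet> e + 1/2 * (norm e)\<^sup>2"
      using Cauchy_Schwarz_ineq2[of "grad (\<lambda>y. F y $ j) x" e]
      by (simp add: algebra_simps power2_eq_square)
    also have "\<dots> \<le> dir_objective F I x e"
      using j by (rule dir_objective_ge)
    finally show ?thesis .
  qed
  with d show ?thesis by blast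
qed

text \<open>Justifies the definite description in \<open>dir\<close>. Existence is compactness; for
  uniqueness, the midpoint of two distinct minimizers stays in the subspace and would have a
  strictly smaller value.\<close>

lemma is_arg_min_dir:
  fixes F :: "real ^ 'n \<Rightarrow> real ^ 'm"
  assumes "I \<noteq> {}"
  shows "is_arg_min (dir_objective F I x) (\<lambda>d. d \<in> dir_space J) (dir F J I x)"
  unfolding dir_def
proof (rule theI')
  show "\<exists>!d. is_arg_min (dir_objective F I x) (\<lambda>d. d \<in> dir_space J) d"
  proof (rule ex_ex1I)
    show "\<exists>d. is_arg_min (dir_objective F I x) (\<lambda>d. d \<in> dir_space J) d"
      using dir_objective_attains_min[OF assms, of J F x] by (auto simp: is_arg_min_linorder)
  next
    fix d e
    assume d: "is_arg_min (dir_objective F I x) (\<lambda>d. d \<in> dir_space J) d"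
      and e: "is_arg_min (dir_objective F I x) (\<lambda>d. d \<in> dir_space J) e"
    have midpoint: "t \<le> 0" if "a \<le> m" "b \<le> m" "m + 1/8 * t \<le> 1/2 * (a + b)" for a b m t :: real
      using that by argo
    have "(1/2) *\<^sub>R (d + e) \<in> dir_space J"
      using d e by (auto simp: is_arg_min_def intro: dir_space_add dir_space_scale)
    then have "dir_objective F I x d \<le> dir_objective F I x ((1/2) *\<^sub>R (d + e))"
      and "dir_objective F I x e \<le> dir_objective F I x ((1/2) *\<^sub>R (d + e))"
      using d e by (auto simp: is_arg_min_linorder)
    then have "(norm (d - e))\<^sup>2 \<le> 0"
      using dir_objective_midpoint[OF assms, of F x d e] midpoint by blast
    then show "d = e" by simp
  qed
qed

lemma dir_in_dir_space: "I \<noteq> {} \<Longrightarrow> dir F J I x \<in> dir_space J"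
  using is_arg_min_dir[of I F x J] by (simp add: is_arg_min_def)

section \<open>Local behaviour of \<open>theta\<close>, of the directions and of the Armijo
  condition\<close>

lemma theta_eq_dir_objective:
  assumes "I \<noteq> {}"
  shows "theta F J I x = dir_objective F I x (dir F J I x)"
  unfolding theta_def using is_arg_min_dir[OF assms, of F x J]
  by (intro cInf_eq_minimum) (auto simp: is_arg_min_linorder)

lemma theta_le_dir_objective:
  assumes "I \<noteq> {}" "d \<in> dir_space J"
  shows "theta F J I x \<le> dir_objective F I x d"
  using is_arg_min_dir[OF assms(1), of F x J] assms
  by (simp add: theta_eq_dir_objective is_arg_min_linorder)

lemma theta_nonpos: "I \<noteq> {} \<Longrightarrow> theta F J I x \<le> 0"
  using theta_le_dir_objective[of I 0 J F x] by simp

text \<open>The maximum in the objective bounds each of its entries; hence a negative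
  \<open>theta\<close> makes \<open>dir\<close> a descent direction for all objectives in
  \<open>I\<close> at once.\<close>

lemma grad_dir_le:
  assumes "j \<in> I"
  shows "grad (\<lambda>y. F y $ j) x \<bullet> dir F J I x + 1/2 * (norm (dir F J I x))\<^sup>2 \<le> theta F J I x"
  using dir_objective_ge[OF assms] assms by (metis empty_iff theta_eq_dir_objective)

text \<open>Since \<open>theta\<close> is at most 0, the quadratic term is dominated by the linear
  one, and Cauchy-Schwarz lets one factor cancel. With continuous gradients this bounds the
  directions locally, without any continuity of \<open>dir\<close>.\<close>

lemma norm_dir_le:
  assumes "j \<in> I"
  shows "norm (dir F J I x) \<le> 2 * norm (grad (\<lambda>y. F y $ j) x)"
proof (cases "dir F J I x = 0")
  case False
  let ?g = "grad (\<lambda>y. F y $ j) x" and ?d = "dir F J I x"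
  have "?g \<bullet> ?d + 1/2 * (norm ?d)\<^sup>2 \<le> 0"
    using grad_dir_le[OF assms, of F x J] theta_nonpos[of I F J x] assms by fastforce
  moreover have "- (?g \<bullet> ?d) \<le> norm ?g * norm ?d"
    using Cauchy_Schwarz_ineq2[of ?g ?d] by (simp add: abs_le_iff)
  ultimately have "1/2 * (norm ?d)\<^sup>2 \<le> norm ?g * norm ?d"
    by argo
  then have "norm ?d * norm ?d \<le> (2 * norm ?g) * norm ?d"
    unfolding power2_eq_square by argo
  then show ?thesis
    using False by (meson mult_right_le_imp_le zero_less_norm_iff)
qed simp

text \<open>Upper semicontinuity: the direction optimal at \<open>a\<close> is kept fixed while
  \<open>x\<close> varies. It stays feasible, so its objective value, which is continuous in
  \<open>x\<close>, bounds \<open>theta\<close> from above.\<close>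

lemma eventually_theta_less:
  fixes F :: "real ^ 'n \<Rightarrow> real ^ 'm"
  assumes "cont_differentiable F" "I \<noteq> {}" "theta F J I a < c"
  shows "eventually (\<lambda>x. theta F J I x < c) (at a)"
proof -
  let ?d = "dir F J I a"
  have "eventually (\<lambda>x. grad (\<lambda>y. F y $ j) x \<bullet> ?d + 1/2 * (norm ?d)\<^sup>2 < c) (at a)"
    if "j \<in> I" for j
  proof (rule order_tendstoD)
    show "((\<lambda>x. grad (\<lambda>y. F y $ j) x \<bullet> ?d + 1/2 * (norm ?d)\<^sup>2)
        \<longlongrightarrow> grad (\<lambda>y. F y $ j) a \<bullet> ?d + 1/2 * (norm ?d)\<^sup>2) (at a)"
      using isCont_grad[OF assms(1)] by (intro tendsto_intros) (simp add: isCont_def)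
    show "grad (\<lambda>y. F y $ j) a \<bullet> ?d + 1/2 * (norm ?d)\<^sup>2 < c"
      using grad_dir_le[OF that, of F a J] assms(3) by linarith
  qed
  then have "eventually (\<lambda>x. \<forall>j\<in>I. grad (\<lambda>y. F y $ j) x \<bullet> ?d + 1/2 * (norm ?d)\<^sup>2 < c) (at a)"
    by (simp add: eventually_ball_finite)
  then show ?thesis
  proof (rule eventually_mono)
    fix x assume "\<forall>j\<in>I. grad (\<lambda>y. F y $ j) x \<bullet> ?d + 1/2 * (norm ?d)\<^sup>2 < c"
    then have "(MAX j\<in>I. grad (\<lambda>y. F y $ j) x \<bullet> ?d) < c - 1/2 * (norm ?d)\<^sup>2"
      using assms(2) by (subst Max_less_iff) (auto simp: less_diff_eq)
    then have "dir_objective F I x ?d < c"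
      by (simp add: dir_objective_def)
    then show "theta F J I x < c"
      using theta_le_dir_objective[OF assms(2) dir_in_dir_space[OF assms(2)], of F J x F a]
      by linarith
  qed
qed
text \<open>By the mean value theorem the decrease along the direction is governed by the slope at
  an intermediate point. This exceeds the slope at \<open>x\<close>, itself at most
  \<open>theta\<close>, by no more than the slack between \<open>theta\<close> and
  \<open>\<gamma> * theta\<close>, because near \<open>a\<close> the gradients vary little and the
  directions are bounded, with constants independent of \<open>x\<close>.\<close>

lemma armijo_locally_uniform:
  fixes F :: "real ^ 'n \<Rightarrow> real ^ 'm"
  assumes F: "cont_differentiable F" and "\<gamma> < 1" and neg: "theta F J UNIV a < 0"
  obtains r t where "0 < r" "0 < t"
    "\<And>x. dist x a < r \<Longrightarrow> theta F J UNIV x < theta F J UNIV a / 2"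
    "\<And>x \<alpha>. dist x a < r \<Longrightarrow> 0 \<le> \<alpha> \<Longrightarrow> \<alpha> \<le> t \<Longrightarrow>
       F (x + \<alpha> *\<^sub>R dir F J UNIV x) \<le> F x + (\<gamma> * \<alpha> * theta F J UNIV x) *\<^sub>R 1"
proof -
  let ?g = "\<lambda>j. grad (\<lambda>y. F y $ j)" and ?d = "dir F J UNIV"
  define c where "c = - theta F J UNIV a / 2"
  have "0 < c" using neg by (simp add: c_def)
  \<comment> \<open>Index types are inhabited, and the gradient of any single objective bounds the
    directions. The added 1 in \<open>R\<close> allows for the change of that gradient near
    \<open>a\<close>.\<close>
  obtain i :: 'm where True by blast
  define R where "R = 2 * (norm (?g i a) + 1)"
  have "0 < R" by (simp add: R_def add_nonneg_pos)
  \<comment> \<open>Two gradients near \<open>a\<close> differ by less than \<open>2 * e\<close>, so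
    slopes along a direction differ by at most \<open>2 * e * R\<close>, which this choice keeps
    below \<open>(1 - \<gamma>) * c\<close>. The cap 1 is what the bound \<open>R\<close> on the
    directions relies on.\<close>
  define e where "e = min 1 ((1 - \<gamma>) * c / (2 * R))"
  have "0 < e" using \<open>0 < c\<close> \<open>0 < R\<close> \<open>\<gamma> < 1\<close> by (simp add: e_def)
  have "theta F J UNIV a < - c" using neg by (simp add: c_def)
  then have "eventually (\<lambda>x. theta F J UNIV x < - c) (at a)"
    using eventually_theta_less[OF F UNIV_not_empty] by blast
  moreover have "eventually (\<lambda>x. \<forall>j. dist (?g j x) (?g j a) < e) (at a)"
    using isCont_grad[OF F] \<open>0 < e\<close>
    by (intro eventually_all_finite tendstoD) (simp_all add: isCont_def)
  ultimately have "eventually (\<lambda>x. theta F J UNIV x < - c \<and> (\<forall>j. dist (?g j x) (?g j a) < e)) (at a)"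
    by (rule eventually_conj)
  then obtain q where "0 < q" and
    "\<And>x. x \<noteq> a \<Longrightarrow> dist x a < q \<Longrightarrow> theta F J UNIV x < - c \<and> (\<forall>j. dist (?g j x) (?g j a) < e)"
    unfolding eventually_at by blast
  \<comment> \<open>The filter \<open>at a\<close> is punctured; the two chained facts supply the
    bounds at \<open>a\<close> itself.\<close>
  with \<open>theta F J UNIV a < - c\<close> \<open>0 < e\<close>
  have near: "theta F J UNIV x < - c" "dist (?g j x) (?g j a) < e" if "dist x a < q" for x j
    using that by (cases "x = a"; simp)+
  have norm_d: "norm (?d x) \<le> R" if "dist x a < q" for x
  proof -
    have "norm (?g i x) \<le> norm (?g i a) + 1"
      using near(2)[OF that, of i] norm_triangle_ineq2[of "?g i x" "?g i a"]
      by (simp add: dist_norm e_def)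
    with norm_dir_le[of i UNIV F J x] show ?thesis by (simp add: R_def)
  qed
  show ?thesis
  proof
    \<comment> \<open>Half of the radius \<open>q\<close> is reserved for \<open>x\<close>, the
      other half for a move of length at most \<open>q / (2 * R) * R\<close>, so that intermediate
      points stay within \<open>q\<close> of \<open>a\<close>.\<close>
    show "0 < q / 2" "0 < q / (2 * R)" using \<open>0 < q\<close> \<open>0 < R\<close> by simp_all
    show "theta F J UNIV x < theta F J UNIV a / 2" if "dist x a < q / 2" for x
      using near(1)[of x] that \<open>0 < q\<close> by (simp add: c_def)
    show "F (x + \<alpha> *\<^sub>R ?d x) \<le> F x + (\<gamma> * \<alpha> * theta F J UNIV x) *\<^sub>R 1"
      if x: "dist x a < q / 2" and \<alpha>: "0 \<le> \<alpha>" "\<alpha> \<le> q / (2 * R)" for x \<alpha>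
    proof (cases "\<alpha> = 0")
      case False
      have xq: "dist x a < q" using x \<open>0 < q\<close> by linarith
      have "F (x + \<alpha> *\<^sub>R ?d x) $ j \<le> F x $ j + \<gamma> * \<alpha> * theta F J UNIV x" for j
      proof -
        obtain \<tau> where \<tau>: "0 < \<tau>" "\<tau> < \<alpha>" and
          mvt: "F (x + \<alpha> *\<^sub>R ?d x) $ j - F (x + 0 *\<^sub>R ?d x) $ j = (\<alpha> - 0) * (?g j (x + \<tau> *\<^sub>R ?d x) \<bullet> ?d x)"
          using MVT2[of 0 \<alpha> "\<lambda>t. F (x + t *\<^sub>R ?d x) $ j" "\<lambda>t. ?g j (x + t *\<^sub>R ?d x) \<bullet> ?d x"]
            DERIV_along_direction[OF F] \<alpha>(1) False by auto
        define \<xi> where "\<xi> = x + \<tau> *\<^sub>R ?d x"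
        have "dist \<xi> x = \<tau> * norm (?d x)"
          using \<tau> by (simp add: \<xi>_def dist_norm)
        also have "\<dots> \<le> q / (2 * R) * R"
          using \<tau> \<alpha> norm_d[OF xq] \<open>0 < q\<close> \<open>0 < R\<close> by (intro mult_mono) auto
        also have "\<dots> = q / 2" using \<open>0 < R\<close> by simp
        finally have "dist \<xi> a < q"
          using x dist_triangle[of \<xi> a x] by linarith
        then have "dist (?g j \<xi>) (?g j x) < 2 * e"
          using near(2)[of \<xi> j] near(2)[OF xq, of j] dist_triangle2[of "?g j \<xi>" "?g j x" "?g j a"]
          by linarith
        then have "(?g j \<xi> - ?g j x) \<bullet> ?d x \<le> (2 * e) * R"
          using norm_cauchy_schwarz[of "?g j \<xi> - ?g j x" "?d x"] norm_d[OF xq] \<open>0 < e\<close>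
          by (smt (verit) dist_norm mult_mono norm_ge_zero)
        also have "\<dots> \<le> (1 - \<gamma>) * c"
        proof -
          have "e \<le> (1 - \<gamma>) * c / (2 * R)" by (simp add: e_def)
          then show ?thesis using \<open>0 < R\<close> by (simp add: field_simps)
        qed
        also have "\<dots> \<le> (1 - \<gamma>) * (- theta F J UNIV x)"
          using near(1)[OF xq] \<open>\<gamma> < 1\<close> by (intro mult_left_mono) auto
        finally have "?g j \<xi> \<bullet> ?d x \<le> ?g j x \<bullet> ?d x + (1 - \<gamma>) * (- theta F J UNIV x)"
          by (simp add: inner_diff_left)
        moreover have "?g j x \<bullet> ?d x + 1/2 * (norm (?d x))\<^sup>2 \<le> theta F J UNIV x"
          by (intro grad_dir_le) simp
        moreover have "0 \<le> (norm (?d x))\<^sup>2" by simp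
        moreover have "theta F J UNIV x + (1 - \<gamma>) * (- theta F J UNIV x) = \<gamma> * theta F J UNIV x"
          by (simp add: algebra_simps)
        ultimately have "?g j \<xi> \<bullet> ?d x \<le> \<gamma> * theta F J UNIV x" by argo
        then have "\<alpha> * (?g j \<xi> \<bullet> ?d x) \<le> \<alpha> * (\<gamma> * theta F J UNIV x)"
          using \<alpha>(1) by (rule mult_left_mono)
        with mvt show ?thesis by (simp add: \<xi>_def mult.left_commute mult.commute)
      qed
      then show ?thesis by (simp add: less_eq_vec_def)
    qed simp
  qed
qed

section \<open>Backtracking steps and uniform decrease under refinement\<close>

lemma Greatest_geometric:
  fixes a \<delta> :: real
  assumes "0 < a" "0 < \<delta>" "\<delta> < 1" "P (a * \<delta> ^ h)"
  defines "g \<equiv> GREATEST \<alpha>. \<exists>h::nat. \<alpha> = a * \<delta> ^ h \<and> P \<alpha>"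
  shows "P g" "0 < g" "a * \<delta> ^ h \<le> g"
proof -
  \<comment> \<open>Powers of \<open>\<delta>\<close> decrease with the exponent, so the largest
    admissible step is attained at the least admissible exponent.\<close>
  define k where "k = (LEAST h. P (a * \<delta> ^ h))"
  have k: "P (a * \<delta> ^ k)" unfolding k_def using assms(4) by (rule LeastI)
  have le: "a * \<delta> ^ l \<le> a * \<delta> ^ k" if "P (a * \<delta> ^ l)" for l
  proof -
    have "k \<le> l" unfolding k_def using that by (rule Least_le)
    then show ?thesis using assms(1-3) by (simp add: power_decreasing)
  qed
  have "g = a * \<delta> ^ k"
    unfolding g_def using k le by (intro Greatest_equality) auto
  then show "P g" "0 < g" "a * \<delta> ^ h \<le> g"
    using k le[OF assms(4)] assms(1,2) by simp_all
qed

lemma ex_geometric_less: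
  fixes a \<delta> t :: real
  assumes "0 < a" "0 < \<delta>" "\<delta> < 1" "0 < t"
  shows "\<exists>h. 0 < a * \<delta> ^ h \<and> a * \<delta> ^ h < t"
proof -
  obtain h where "\<delta> ^ h < t / a"
    using real_arch_pow_inv[of "t / a" \<delta>] assms by auto
  then show ?thesis using assms by (auto simp: field_simps)
qed

lemma armijo_step_ge:
  fixes F :: "real ^ 'n \<Rightarrow> real ^ 'm" and x :: "real ^ 'n"
  assumes "0 < \<alpha>0" "0 < \<delta>" "\<delta> < 1" "theta F J UNIV x < 0"
    and "F (x + (\<alpha>0 * \<delta> ^ h) *\<^sub>R dir F J UNIV x) \<le> F x + (\<gamma> * (\<alpha>0 * \<delta> ^ h) * theta F J UNIV x) *\<^sub>R 1"
  shows "\<alpha>0 * \<delta> ^ h \<le> armijo_step F \<alpha>0 \<delta> \<gamma> J x"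
    and "F (refine_point F \<alpha>0 \<delta> \<gamma> J x)
      \<le> F x + (\<gamma> * armijo_step F \<alpha>0 \<delta> \<gamma> J x * theta F J UNIV x) *\<^sub>R 1"
proof -
  define P where "P \<alpha> \<longleftrightarrow> F (x + \<alpha> *\<^sub>R dir F J UNIV x) \<le> F x + (\<gamma> * \<alpha> * theta F J UNIV x) *\<^sub>R 1" for \<alpha>
  have "P (\<alpha>0 * \<delta> ^ h)"
    unfolding P_def by (rule assms(5))
  note greatest = Greatest_geometric(1,3)[of \<alpha>0 \<delta> P, OF assms(1-3) this]
  have step: "armijo_step F \<alpha>0 \<delta> \<gamma> J x = (GREATEST \<alpha>. \<exists>h::nat. \<alpha> = \<alpha>0 * \<delta> ^ h \<and> P \<alpha>)"
    using assms(4) by (simp only: armijo_step_def P_def if_True)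
  show "\<alpha>0 * \<delta> ^ h \<le> armijo_step F \<alpha>0 \<delta> \<gamma> J x"
    unfolding step by (rule greatest(2))
  have "P (armijo_step F \<alpha>0 \<delta> \<gamma> J x)"
    unfolding step by (rule greatest(1))
  then show "F (refine_point F \<alpha>0 \<delta> \<gamma> J x)
      \<le> F x + (\<gamma> * armijo_step F \<alpha>0 \<delta> \<gamma> J x * theta F J UNIV x) *\<^sub>R 1"
    unfolding P_def refine_point_def .
qed

text \<open>One trial step below the uniform threshold is admissible at all points near
  \<open>a\<close>, and backtracking accepts a step at least that large. Since \<open>theta\<close>
  stays below half its value at \<open>a\<close>, the Armijo inequality gives a common decrease for
  all objectives.\<close>

lemma refine_point_decrease_locally_uniform:
  fixes F :: "real ^ 'n \<Rightarrow> real ^ 'm" and a :: "real ^ 'n"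
  assumes "cont_differentiable F" "0 < \<alpha>0" "0 < \<delta>" "\<delta> < 1" "0 < \<gamma>" "\<gamma> < 1"
    and neg: "theta F J UNIV a < 0"
  obtains r c where "0 < r" "0 < c"
    "\<And>x j. dist x a < r \<Longrightarrow> F (refine_point F \<alpha>0 \<delta> \<gamma> J x) $ j \<le> F x $ j - c"
proof -
  obtain r t where "0 < r" "0 < t"
    and theta: "\<And>x. dist x a < r \<Longrightarrow> theta F J UNIV x < theta F J UNIV a / 2"
    and armijo: "\<And>x \<alpha>. dist x a < r \<Longrightarrow> 0 \<le> \<alpha> \<Longrightarrow> \<alpha> \<le> t \<Longrightarrow>
       F (x + \<alpha> *\<^sub>R dir F J UNIV x) \<le> F x + (\<gamma> * \<alpha> * theta F J UNIV x) *\<^sub>R 1"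
    using armijo_locally_uniform[OF assms(1,6) neg] by blast
  obtain h where h: "0 < \<alpha>0 * \<delta> ^ h" "\<alpha>0 * \<delta> ^ h < t"
    using ex_geometric_less assms(2-4) \<open>0 < t\<close> by metis
  show ?thesis
  proof
    show "0 < r" by fact
    have "0 < - theta F J UNIV a / 2" using neg by simp
    then show "0 < \<gamma> * (\<alpha>0 * \<delta> ^ h) * (- theta F J UNIV a / 2)"
      using h(1) assms(5) mult_pos_pos by blast
    fix x j assume x: "dist x a < r"
    have "theta F J UNIV x < 0" using theta[OF x] neg by linarith
    note step = armijo_step_ge[OF assms(2-4) this armijo[OF x less_imp_le[OF h(1)] less_imp_le[OF h(2)]]]
    let ?s = "armijo_step F \<alpha>0 \<delta> \<gamma> J x"
    have decrease: "\<gamma> * (\<alpha>0 * \<delta> ^ h) * (- theta F J UNIV a / 2) \<le> \<gamma> * ?s * (- theta F J UNIV x)"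
    proof (rule mult_mono)
      show "\<gamma> * (\<alpha>0 * \<delta> ^ h) \<le> \<gamma> * ?s"
        using step(1) assms(5) by simp
      show "- theta F J UNIV a / 2 \<le> - theta F J UNIV x"
        using theta[OF x] by simp
      show "0 \<le> \<gamma> * ?s"
        using less_le_trans[OF h(1) step(1)] assms(5) by simp
      show "0 \<le> - theta F J UNIV a / 2"
        using neg by simp
    qed
    have "F (refine_point F \<alpha>0 \<delta> \<gamma> J x) $ j \<le> F x $ j + \<gamma> * ?s * theta F J UNIV x"
      using step(2) by (simp add: less_eq_vec_def)
    also have "\<dots> = F x $ j - \<gamma> * ?s * (- theta F J UNIV x)"
      by simp
    also have "\<dots> \<le> F x $ j - \<gamma> * (\<alpha>0 * \<delta> ^ h) * (- theta F J UNIV a / 2)"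
      using decrease by (rule diff_left_mono)
    finally show "F (refine_point F \<alpha>0 \<delta> \<gamma> J x) $ j
        \<le> F x $ j - \<gamma> * (\<alpha>0 * \<delta> ^ h) * (- theta F J UNIV a / 2)" .
  qed
qed

text \<open>With a negative \<open>theta\<close>, the local decrease is used with \<open>x\<close>
  as its own centre; otherwise the step is 0 and the point does not move.\<close>

lemma refine_point_le:
  fixes F :: "real ^ 'n \<Rightarrow> real ^ 'm" and x :: "real ^ 'n"
  assumes "cont_differentiable F" "0 < \<alpha>0" "0 < \<delta>" "\<delta> < 1" "0 < \<gamma>" "\<gamma> < 1"
  shows "F (refine_point F \<alpha>0 \<delta> \<gamma> J x) \<le> F x"
proof (cases "theta F J UNIV x < 0")
  case True
  then obtain r c where "0 < r" "0 < c"
    and decrease: "\<And>y j. dist y x < r \<Longrightarrow> F (refine_point F \<alpha>0 \<delta> \<gamma> J y) $ j \<le> F y $ j - c"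
    using refine_point_decrease_locally_uniform[OF assms] by blast
  have "F (refine_point F \<alpha>0 \<delta> \<gamma> J x) $ j \<le> F x $ j" for j
    using decrease[of x j] \<open>0 < r\<close> \<open>0 < c\<close> by simp
  then show ?thesis by (simp add: less_eq_vec_def)
next
  case False
  then show ?thesis by (simp add: refine_point_def armijo_step_def)
qed

section \<open>Points added to the archive: support and nondominance\<close>

lemma refine_point_in_dir_space:
  assumes "x \<in> dir_space J"
  shows "refine_point F \<alpha>0 \<delta> \<gamma> J x \<in> dir_space J"
  unfolding refine_point_def
  using assms by (intro dir_space_add dir_space_scale dir_in_dir_space) auto

lemma explore_point_in_dir_space:
  assumes "z \<in> dir_space J" "I \<noteq> {}"
  shows "explore_point F \<alpha>0 \<delta> J I z X \<in> dir_space J"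
  unfolding explore_point_def
  using assms by (intro dir_space_add dir_space_scale dir_in_dir_space) auto

lemma not_less_vec_imp:
  fixes u v :: "real ^ 'm"
  assumes "\<not> u < v"
  shows "u = v \<or> (\<exists>j. v $ j < u $ j)"
  using assms by (auto simp: less_le less_eq_vec_def not_le)

text \<open>The value of \<open>explore_step\<close> is meaningful only once some trial step is
  admissible. For each archive point all sufficiently small steps are; finiteness of the front gives
  one threshold for all of them, and geometric backtracking gets below it.\<close>

lemma explore_point_not_dominated:
  fixes F :: "real ^ 'n \<Rightarrow> real ^ 'm" and z :: "real ^ 'n"
  assumes F: "cont_differentiable F" and "0 < \<alpha>0" "0 < \<delta>" "\<delta> < 1"
    and "finite (front X J)" and nondom: "mutually_nondominated F (front X J)"
    and z: "z \<in> front X J" and "I \<noteq> {}" and neg: "theta F J I z < 0"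
    and "y \<in> front X J"
  shows "\<not> F y < F (explore_point F \<alpha>0 \<delta> J I z X)"
proof -
  let ?d = "dir F J I z"
  have "eventually (\<lambda>t. \<exists>j. F (z + t *\<^sub>R ?d) $ j < F y $ j) (at_right 0)"
    if y: "y \<in> front X J" for y
  proof -
    have "\<not> F y < F z"
      using nondom y z by (simp add: mutually_nondominated_def)
    then consider "F y = F z" | j where "F z $ j < F y $ j"
      using not_less_vec_imp by blast
    then show ?thesis
    proof cases
      case 1
      \<comment> \<open>When \<open>y\<close> ties with \<open>z\<close>, continuity is not enough:
        strict first-order descent of an objective in \<open>I\<close> breaks the tie.\<close>
      obtain j where "j \<in> I" using \<open>I \<noteq> {}\<close> by blast
      have "grad (\<lambda>y. F y $ j) z \<bullet> ?d < 0"
        using grad_dir_le[OF \<open>j \<in> I\<close>, of F z J] neg zero_le_power2[of "norm ?d"] by argo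
      then obtain e where "0 < e" "\<And>t. 0 < t \<Longrightarrow> t < e \<Longrightarrow> F (z + t *\<^sub>R ?d) $ j < F z $ j"
        using DERIV_neg_dec_right[OF DERIV_along_direction[OF F, of z ?d j 0]] by auto
      then show ?thesis
        unfolding eventually_at_right_field using 1 by auto
    next
      case 2
      \<comment> \<open>A strict advantage of \<open>z\<close> in component \<open>j\<close>
        survives small steps by continuity.\<close>
      have "isCont (\<lambda>t. F (z + t *\<^sub>R ?d) $ j) 0"
        using DERIV_along_direction[OF F] by (rule DERIV_isCont)
      then have "((\<lambda>t. F (z + t *\<^sub>R ?d) $ j) \<longlongrightarrow> F z $ j) (at_right 0)"
        by (auto simp: isCont_def intro: tendsto_within_subset)
      from order_tendstoD(2)[OF this 2] show ?thesis
        by (rule eventually_mono) blast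
    qed
  qed
  then have "eventually (\<lambda>t. \<forall>y\<in>front X J. \<exists>j. F (z + t *\<^sub>R ?d) $ j < F y $ j) (at_right 0)"
    using \<open>finite (front X J)\<close> by (intro eventually_ball_finite) auto
  then obtain e where "0 < e"
    and e: "\<And>t. 0 < t \<Longrightarrow> t < e \<Longrightarrow> \<forall>y\<in>front X J. \<exists>j. F (z + t *\<^sub>R ?d) $ j < F y $ j"
    unfolding eventually_at_right_field by auto
  obtain h where h: "0 < \<alpha>0 * \<delta> ^ h" "\<alpha>0 * \<delta> ^ h < e"
    using ex_geometric_less assms(2-4) \<open>0 < e\<close> by metis
  have "\<forall>y\<in>front X J. \<exists>j. F (explore_point F \<alpha>0 \<delta> J I z X) $ j < F y $ j"
    unfolding explore_point_def explore_step_def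
    by (rule Greatest_geometric(1)[OF assms(2-4), of _ h]) (rule e[OF h])
  then obtain j where "F (explore_point F \<alpha>0 \<delta> J I z X) $ j < F y $ j"
    using \<open>y \<in> front X J\<close> by blast
  then show ?thesis
    by (meson less_eq_vec_def less_imp_le not_le)
qed

section \<open>Covering: updates of an archive lose no quality\<close>

definition covers :: "(real ^ 'n \<Rightarrow> real ^ 'm) \<Rightarrow> 'n archive \<Rightarrow> 'n archive \<Rightarrow> bool" where
  "covers F Y X \<longleftrightarrow> (\<forall>(x, J)\<in>X. \<exists>y. (y, J) \<in> Y \<and> F y \<le> F x)"

lemma coversD: "covers F Y X \<Longrightarrow> (x, J) \<in> X \<Longrightarrow> \<exists>y. (y, J) \<in> Y \<and> F y \<le> F x"
  by (auto simp: covers_def)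

lemma covers_refl: "covers F X X"
  by (auto simp: covers_def)

lemma covers_trans:
  assumes "covers F Z Y" "covers F Y X"
  shows "covers F Z X"
  unfolding covers_def
proof clarify
  fix x J assume "(x, J) \<in> X"
  then obtain y where "(y, J) \<in> Y" "F y \<le> F x"
    using coversD[OF assms(2)] by blast
  moreover from this(1) obtain z where "(z, J) \<in> Z" "F z \<le> F y"
    using coversD[OF assms(1)] by blast
  ultimately show "\<exists>z. (z, J) \<in> Z \<and> F z \<le> F x"
    by (blast intro: order_trans)
qed

lemma covers_fold:
  assumes "\<And>p X. covers F (f p X) X"
  shows "covers F (fold f ps X) X"
  by (rule fold_invariant[where Q = "\<lambda>_. True" and P = "\<lambda>Y. covers F Y X"])
    (auto intro: covers_refl covers_trans[OF assms])

text \<open>A pair is deleted only when the inserted point dominates it and carries the same support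
  set, so the inserted point is its replacement; every other pair covers itself.\<close>

lemma covers_insert_filter: "covers F (insert_filter F J z X) X"
  unfolding covers_def
proof clarify
  fix x K assume "(x, K) \<in> X"
  then show "\<exists>y. (y, K) \<in> insert_filter F J z X \<and> F y \<le> F x"
    by (cases "K = J \<and> F z < F x") (auto simp: insert_filter_def intro: less_imp_le)
qed

lemma covers_explore: "covers F (explore F \<alpha>0 \<delta> J z I X) X"
  by (simp add: explore_def covers_refl covers_insert_filter)

lemma covers_treat: "covers F (treat F \<alpha>0 \<delta> \<gamma> Is p X) X"
  unfolding treat_def Let_def
  by (auto intro: covers_refl covers_trans[OF covers_fold[OF covers_explore] covers_insert_filter])

section \<open>The archive invariant\<close>

lemma sfsd_initD:
  assumes "sfsd_init F s X" "(x, J) \<in> X"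
  shows "x \<in> sparse_set s" "x \<in> dir_space J" "card J = s"
  using assms by (auto simp: sfsd_init_def super_supports_def supp_subset_iff)

lemma finite_front: "sfsd_init F s X \<Longrightarrow> finite (front X J)"
  by (rule finite_subset[of _ "fst ` X"]) (force simp: sfsd_init_def front_def)+

text \<open>The conditions on the initial archive double as the loop invariant. Filtering removes
  what the new point dominates, and the last hypothesis excludes points that dominate it, so
  nondominance persists in both directions.\<close>

lemma sfsd_init_insert_filter:
  assumes X: "sfsd_init F s X" and z: "z \<in> dir_space J" "card J = s"
    and nondom: "\<And>y. y \<in> front X J \<Longrightarrow> \<not> F y < F z"
  shows "sfsd_init F s (insert_filter F J z X)"
proof -
  have "card (supp z) \<le> s"
    using z card_mono[of J "supp z"] by (simp add: supp_subset_iff)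
  moreover have "mutually_nondominated F (front (insert_filter F J z X) K)" for K
  proof -
    have "mutually_nondominated F (front X K)"
      using X by (simp add: sfsd_init_def)
    then show ?thesis
      using nondom by (auto simp: mutually_nondominated_def front_def insert_filter_def)
  qed
  ultimately show ?thesis
    using X z by (auto simp: sfsd_init_def insert_filter_def sparse_set_def super_supports_def supp_subset_iff)
qed

lemma sfsd_init_explore:
  assumes "cont_differentiable F" "0 < \<alpha>0" "0 < \<delta>" "\<delta> < 1"
    and X: "sfsd_init F s X" and I: "I \<noteq> {}" "theta F J I z < 0"
  shows "sfsd_init F s (explore F \<alpha>0 \<delta> J z I X)"
proof (cases "(z, J) \<in> X")
  case True
  have "mutually_nondominated F (front X J)"
    using X by (simp add: sfsd_init_def)
  moreover have "z \<in> front X J"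
    using True by (simp add: front_def)
  ultimately have "\<not> F y < F (explore_point F \<alpha>0 \<delta> J I z X)" if "y \<in> front X J" for y
    using explore_point_not_dominated[OF assms(1-4) finite_front[OF X]] I that by blast
  then have "sfsd_init F s (insert_filter F J (explore_point F \<alpha>0 \<delta> J I z X) X)"
    using sfsd_initD[OF X True] I(1)
    by (intro sfsd_init_insert_filter[OF X] explore_point_in_dir_space)
  with True show ?thesis by (simp add: explore_def)
qed (simp add: explore_def X)

lemma sfsd_init_treat:
  assumes "cont_differentiable F" "0 < \<alpha>0" "0 < \<delta>" "\<delta> < 1" "0 < \<gamma>" "\<gamma> < 1"
    and X: "sfsd_init F s X"
    and Is: "\<And>I. I \<in> set (Is (x, J)) \<Longrightarrow> I \<noteq> {} \<and> theta F J I (refine_point F \<alpha>0 \<delta> \<gamma> J x) < 0"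
  shows "sfsd_init F s (treat F \<alpha>0 \<delta> \<gamma> Is (x, J) X)"
proof (cases "(x, J) \<in> X")
  case True
  let ?z = "refine_point F \<alpha>0 \<delta> \<gamma> J x"
  \<comment> \<open>Refinement raises no objective, so a point dominating \<open>?z\<close> would
    dominate \<open>x\<close>, which is still in the archive.\<close>
  have "\<not> F y < F ?z" if "y \<in> front X J" for y
  proof
    assume "F y < F ?z"
    also have "F ?z \<le> F x" using assms(1-6) by (rule refine_point_le)
    finally show False
      using X True that by (auto simp: sfsd_init_def mutually_nondominated_def front_def)
  qed
  then have "sfsd_init F s (insert_filter F J ?z X)"
    using sfsd_initD[OF X True] by (intro sfsd_init_insert_filter[OF X] refine_point_in_dir_space)
  then have "sfsd_init F s (fold (explore F \<alpha>0 \<delta> J ?z) (Is (x, J)) (insert_filter F J ?z X))"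
    using fold_invariant[where Q = "\<lambda>I. I \<noteq> {} \<and> theta F J I ?z < 0" and P = "sfsd_init F s"]
      sfsd_init_explore[OF assms(1-4)] Is by blast
  with True show ?thesis by (simp add: treat_def Let_def)
qed (simp add: treat_def X)

text \<open>Whether \<open>y\<close> is the refined point or an explored one, treating
  \<open>x\<close> inserts the refined point first. The explorations and the remaining pairs of the
  iteration then produce only archives that cover it.\<close>

lemma generated_by_imp_refine_point_covered:
  assumes "generated_by F \<alpha>0 \<delta> \<gamma> X ps Is J x y"
  shows "\<exists>w. (w, J) \<in> fold (treat F \<alpha>0 \<delta> \<gamma> Is) ps X \<and> F w \<le> F (refine_point F \<alpha>0 \<delta> \<gamma> J x)"
proof -
  let ?t = "treat F \<alpha>0 \<delta> \<gamma> Is" and ?z = "refine_point F \<alpha>0 \<delta> \<gamma> J x"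
  obtain i where i: "i < length ps" "ps ! i = (x, J)"
    and x: "(x, J) \<in> fold ?t (take i ps) X"
    using assms by (auto simp: generated_by_def Let_def)
  define Y where "Y = fold ?t (take i ps) X"
  define Z where "Z = insert_filter F J ?z Y"
  \<comment> \<open>Splitting the enumeration at position \<open>i\<close> isolates the moment at
    which \<open>x\<close> is treated.\<close>
  have "ps = take i ps @ (x, J) # drop (Suc i) ps"
    using id_take_nth_drop[OF i(1)] i(2) by simp
  then have "fold ?t ps X = fold ?t (drop (Suc i) ps) (?t (x, J) Y)"
    unfolding Y_def by (metis comp_apply fold_append fold_simps(2))
  also have "?t (x, J) Y = fold (explore F \<alpha>0 \<delta> J ?z) (Is (x, J)) Z"
    using x by (simp add: treat_def Let_def Y_def Z_def)
  finally have fold_eq: "fold ?t ps X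
      = fold ?t (drop (Suc i) ps) (fold (explore F \<alpha>0 \<delta> J ?z) (Is (x, J)) Z)" .
  have "covers F (fold ?t ps X) Z"
    unfolding fold_eq by (rule covers_trans[OF covers_fold covers_fold]) (rule covers_treat covers_explore)+
  moreover have "(?z, J) \<in> Z"
    by (simp add: Z_def insert_filter_def)
  ultimately show ?thesis by (rule coversD)
qed

section \<open>Invariance and covering along a run\<close>

lemma sfsd_run_invariant:
  assumes "cont_differentiable F" "0 < \<alpha>0" "0 < \<delta>" "\<delta> < 1" "0 < \<gamma>" "\<gamma> < 1"
    and run: "sfsd_run F s \<alpha>0 \<delta> \<gamma> X ps Is"
  shows "sfsd_init F s (X k)"
proof (induction k)
  case 0
  then show ?case using run by (simp add: sfsd_run_def)
next
  case (Suc k)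
  have "sfsd_init F s (fold (treat F \<alpha>0 \<delta> \<gamma> (Is k)) (ps k) (X k))"
  \<comment> \<open>The fold runs over the pairs of \<open>X k\<close>, not of the changing archive;
    it is for these that the run specifies the list \<open>Is k\<close>.\<close>
  proof (rule fold_invariant[where Q = "\<lambda>p. p \<in> X k"])
    fix p Y assume p: "p \<in> X k" and Y: "sfsd_init F s Y"
    obtain x J where [simp]: "p = (x, J)" by fastforce
    have "set (Is k (x, J)) = {I. I \<noteq> {} \<and> theta F J I (refine_point F \<alpha>0 \<delta> \<gamma> J x) < 0}"
      using run p by (fastforce simp: sfsd_run_def)
    then show "sfsd_init F s (treat F \<alpha>0 \<delta> \<gamma> (Is k) p Y)"
      using sfsd_init_treat[OF assms(1-6) Y, of "Is k" x J] by simp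
  qed (use Suc.IH run in \<open>auto simp: sfsd_run_def\<close>)
  then show ?case using run by (simp add: sfsd_run_def)
qed

lemma sfsd_run_covers:
  assumes "sfsd_run F s \<alpha>0 \<delta> \<gamma> X ps Is" "k \<le> l"
  shows "covers F (X l) (X k)"
  using assms(2)
proof (induction l rule: dec_induct)
  case base
  show ?case by (rule covers_refl)
next
  case (step l)
  have "covers F (X (Suc l)) (X l)"
    using assms(1) by (simp add: sfsd_run_def covers_fold covers_treat)
  then show ?case using step.IH by (rule covers_trans)
qed

section \<open>Accumulation points of linked sequences\<close>

theorem proposition4:
  fixes F :: "real ^ 'n \<Rightarrow> real ^ 'm"
    and s :: nat
    and \<alpha>0 \<delta> \<gamma> :: real
    and X :: "nat \<Rightarrow> ((real ^ 'n) \<times> 'n set) set"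
    and ps :: "nat \<Rightarrow> ((real ^ 'n) \<times> 'n set) list"
    and Is :: "nat \<Rightarrow> (real ^ 'n) \<times> 'n set \<Rightarrow> 'm set list"
    and J :: "'n set"
    and x0 :: "real ^ 'n"
    and xs :: "nat \<Rightarrow> real ^ 'n"
  assumes "cont_differentiable F"
    and "1 \<le> s" and "s < CARD('n)"
    and "0 < \<alpha>0" and "0 < \<delta>" and "\<delta> < 1" and "0 < \<gamma>" and "\<gamma> < 1"
    and "sfsd_run F s \<alpha>0 \<delta> \<gamma> X ps Is"
    and "card J = s"
    and "mutually_nondominated F (front (X 0) J)"
    and "x0 \<in> front (X 0) J"
    and "compact (\<Union>j. {x \<in> sparse_set s. F x $ j \<le> F x0 $ j})"
    and "linked_sequence F \<alpha>0 \<delta> \<gamma> X ps Is J xs"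
  shows "(\<exists>a. accumulation_point xs a) \<and> (\<forall>a. accumulation_point xs a \<longrightarrow> MOLZ F s a)"
proof -
  note params = assms(1,4-8)
  note run = assms(9) and linked = assms(14)
  note inv = sfsd_run_invariant[OF params run]
  have xs: "(xs k, J) \<in> X k" for k
    using linked by (simp add: linked_sequence_def front_def)
  \<comment> \<open>The inequality is not strict because \<open>y\<close> may have the same
    objective values as \<open>xs k\<close>.\<close>
  have nondominated: "\<exists>j. F (xs k) $ j \<le> F y $ j" if "(y, J) \<in> X k" for y k
  proof -
    have "mutually_nondominated F (front (X k) J)"
      using inv[of k] by (simp add: sfsd_init_def)
    then have "\<not> F y < F (xs k)"
      using that xs by (simp add: mutually_nondominated_def front_def)
    then show ?thesis
      using not_less_vec_imp[of "F y" "F (xs k)"] by (auto intro: less_imp_le)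
  qed
  let ?K = "\<Union>j. {x \<in> sparse_set s. F x $ j \<le> F x0 $ j}"
  \<comment> \<open>At stage \<open>k\<close> some archive point is at least as good as
    \<open>x0\<close>, and \<open>xs k\<close> is no worse than it in some component. That component
    may change with \<open>k\<close>, which is why compactness of the whole union is
    required.\<close>
  have "xs k \<in> ?K" for k
  proof -
    have "covers F (X k) (X 0)"
      using sfsd_run_covers[OF run] by simp
    then obtain y where y: "(y, J) \<in> X k" "F y \<le> F x0"
      using coversD assms(12) by (fastforce simp: front_def)
    with nondominated obtain j where "F (xs k) $ j \<le> F y $ j"
      by blast
    also have "F y $ j \<le> F x0 $ j"
      using y(2) by (simp add: less_eq_vec_def)
    finally show ?thesis
      using sfsd_initD(1)[OF inv xs] by blast
  qed
  then have "\<exists>a. accumulation_point xs a"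
    using assms(13) unfolding compact_def accumulation_point_def by meson
  moreover have "MOLZ F s a" if acc: "accumulation_point xs a" for a
  proof -
    obtain r where r: "strict_mono r" "(xs \<circ> r) \<longlonglongrightarrow> a"
      using acc by (auto simp: accumulation_point_def)
    \<comment> \<open>All iterates lie in the closed coordinate subspace of \<open>J\<close>, so
      \<open>J\<close> remains a super support set of the limit.\<close>
    have "a \<in> dir_space J"
      using closed_sequentially[OF closed_dir_space _ r(2)] sfsd_initD(2)[OF inv xs] by simp
    then have "supp a \<subseteq> J"
      by (simp add: supp_subset_iff)
    moreover have "\<not> theta F J UNIV a < 0"
    proof
      assume "theta F J UNIV a < 0"
      then obtain q c where "0 < q" "0 < c" and
        decrease: "\<And>x j. dist x a < q \<Longrightarrow> F (refine_point F \<alpha>0 \<delta> \<gamma> J x) $ j \<le> F x $ j - c"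
        using refine_point_decrease_locally_uniform[OF params] by blast
      have "(\<lambda>n. F (xs (r n))) \<longlonglongrightarrow> F a"
        using isCont_tendsto_compose[OF isCont_cont_differentiable[OF assms(1)] r(2)]
        by (simp add: comp_def)
      then have "eventually (\<lambda>n. dist (F (xs (r n))) (F a) < c / 2) sequentially"
        using \<open>0 < c\<close> by (intro tendstoD) auto
      moreover have "eventually (\<lambda>n. dist (xs (r n)) a < q) sequentially"
        using tendstoD[OF r(2) \<open>0 < q\<close>] by simp
      ultimately have "eventually (\<lambda>n. dist (F (xs (r n))) (F a) < c / 2 \<and> dist (xs (r n)) a < q) sequentially"
        by (rule eventually_conj)
      \<comment> \<open>Two successive terms of the subsequence suffice: with tolerance
        \<open>c / 2\<close> their objective values are less than \<open>c\<close> apart.\<close>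
      then obtain N where N: "\<And>n. n \<ge> N \<Longrightarrow> dist (F (xs (r n))) (F a) < c / 2"
        "dist (xs (r N)) a < q"
        unfolding eventually_sequentially by blast
      let ?k = "r N" and ?l = "r (Suc N)"
      have "generated_by F \<alpha>0 \<delta> \<gamma> (X ?k) (ps ?k) (Is ?k) J (xs ?k) (xs (Suc ?k))"
        using linked by (simp add: linked_sequence_def)
      moreover have "X (Suc ?k) = fold (treat F \<alpha>0 \<delta> \<gamma> (Is ?k)) (ps ?k) (X ?k)"
        using run unfolding sfsd_run_def by blast
      ultimately obtain w where w: "(w, J) \<in> X (Suc ?k)"
        "F w \<le> F (refine_point F \<alpha>0 \<delta> \<gamma> J (xs ?k))"
        using generated_by_imp_refine_point_covered[of F \<alpha>0 \<delta> \<gamma> "X ?k"] by metis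
      \<comment> \<open>The later term belongs to an archive no earlier than the one holding
        \<open>w\<close>, so covering carries the decrease made at \<open>?k\<close> over to
        \<open>?l\<close>.\<close>
      have "Suc ?k \<le> ?l"
        using r(1) by (simp add: Suc_le_eq strict_mono_Suc_iff)
      from coversD[OF sfsd_run_covers[OF run this] w(1)]
      obtain v where v: "(v, J) \<in> X ?l" "F v \<le> F w"
        by blast
      obtain j where "F (xs ?l) $ j \<le> F v $ j"
        using nondominated v(1) by blast
      also have "\<dots> \<le> F (refine_point F \<alpha>0 \<delta> \<gamma> J (xs ?k)) $ j"
        using order_trans[OF v(2) w(2)] by (simp add: less_eq_vec_def)
      also have "\<dots> \<le> F (xs ?k) $ j - c"
        using N(2) by (rule decrease)
      finally have "c \<le> dist (F (xs ?k) $ j) (F (xs ?l) $ j)"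
        by (simp add: dist_real_def)
      also have "\<dots> \<le> dist (F (xs ?k)) (F (xs ?l))"
        by (rule dist_vec_nth_le)
      also have "\<dots> < c / 2 + c / 2"
        using N(1)[of N] N(1)[of "Suc N"] by (intro dist_triangle_less_add) simp_all
      finally show False by simp
    qed
    then have "theta F J UNIV a = 0"
      using theta_nonpos[of UNIV F J a] by auto
    moreover have "card (supp a) \<le> s"
      using \<open>supp a \<subseteq> J\<close> assms(10) by (metis card_mono finite)
    ultimately show ?thesis
      using assms(10) by (auto simp: MOLZ_def sparse_set_def super_supports_def)
  qed
  ultimately show ?thesis by blast
qed

end
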